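(* Let $V$ be a finite non-empty set and let $v:2^V\to[0,1]$ be a set function with $v(\emptyset)=0$ that is supermodular, i.e. $$v(S)+v(T)\leq v(S\cup T)+v(S\cap T)\quad\text{for all } S,T\subseteq V.$$ Let $\Gamma$ be a group acting transitively on $V$, and suppose that $v$ is invariant under the action of $\Gamma$. Then for any $U\subseteq V$, $$v(U)\leq \frac{|U|}{|V|}\,v(V).$$
   Context: Invariance of $v$ under $\Gamma$ means $v(\gamma S)=v(S)$ for all $\gamma\in\Gamma$ and $S\subseteq V$, where $\gamma S$ is the image of $S$ under $\gamma$. *)

theory Defs
  imports Complex_Main "HOL-Algebra.Group_Action"
begin

definition supermodular_on :: "'a set \<Rightarrow> ('a set \<Rightarrow> real) \<Rightarrow> bool" where
  "supermodular_on V v \<longleftrightarrow>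
     (\<forall>S T. S \<subseteq> V \<longrightarrow> T \<subseteq> V \<longrightarrow> v S + v T \<le> v (S \<union> T) + v (S \<inter> T))"

definition invariant_under ::
  "('g, 'm) monoid_scheme \<Rightarrow> ('g \<Rightarrow> 'a \<Rightarrow> 'a) \<Rightarrow> 'a set \<Rightarrow> ('a set \<Rightarrow> real) \<Rightarrow> bool" where
  "invariant_under G \<phi> V v \<longleftrightarrow>
     (\<forall>g \<in> carrier G. \<forall>S. S \<subseteq> V \<longrightarrow> v (\<phi> g ` S) = v S)"

end

theory Submission
  imports Defs
begin

text \<open>
  Let \<open>c\<close> be the maximum of \<open>v S / |S|\<close> over the non-empty \<open>S \<subseteq> V\<close>. Then \<open>S \<mapsto> v S - c |S|\<close> is
  supermodular and nowhere positive, so its zeros are closed under union. The zeros are also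
  closed under the action, and by transitivity the translates of a non-empty zero cover \<open>V\<close>. Hence
  \<open>V\<close> is a zero, that is \<open>c = v V / |V|\<close>. This replaces averaging over the group, which may be
  infinite.
\<close>

text \<open>Cardinality is modular on finite sets, so subtracting a multiple of it, of either sign,
  keeps the inequality.\<close>

lemma supermodular_on_minus_card:
  assumes "finite V" and "supermodular_on V v"
  shows "supermodular_on V (\<lambda>S. v S - c * real (card S))"
  unfolding supermodular_on_def
proof (intro allI impI)
  fix S T assume ST: "S \<subseteq> V" "T \<subseteq> V"
  then have "card S + card T = card (S \<union> T) + card (S \<inter> T)"
    using assms(1) by (intro card_Un_Int) (auto intro: finite_subset)
  then have "c * real (card S) + c * real (card T)
      = c * real (card (S \<union> T)) + c * real (card (S \<inter> T))"
    by (metis distrib_left of_nat_add)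
  moreover have "v S + v T \<le> v (S \<union> T) + v (S \<inter> T)"
    using assms(2) ST by (simp add: supermodular_on_def)
  ultimately show "v S - c * real (card S) + (v T - c * real (card T))
      \<le> v (S \<union> T) - c * real (card (S \<union> T)) + (v (S \<inter> T) - c * real (card (S \<inter> T)))"
    by linarith
qed

text \<open>For zeros \<open>S\<close> and \<open>T\<close>, supermodularity gives 0 \<le> f (S
  \<union> T) + f (S \<inter> T). Neither summand is positive, so both vanish.\<close>

lemma supermodular_on_Union_eq_0:
  assumes "supermodular_on V f" and nonpos: "\<And>S. S \<subseteq> V \<Longrightarrow> f S \<le> 0" and "f {} = 0"
    and "finite F" and "\<And>S. S \<in> F \<Longrightarrow> S \<subseteq> V \<and> f S = 0"
  shows "f (\<Union>F) = 0"
  using assms(4,5)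
proof (induction F rule: finite_induct)
  case empty
  then show ?case using \<open>f {} = 0\<close> by simp
next
  case (insert S F)
  have sub: "S \<subseteq> V" "\<Union>F \<subseteq> V" and "f S = 0"
    using insert.prems by auto
  have "f S + f (\<Union>F) \<le> f (S \<union> \<Union>F) + f (S \<inter> \<Union>F)"
    using assms(1) sub by (simp add: supermodular_on_def)
  moreover have "f (\<Union>F) = 0"
    using insert by simp
  moreover have "f (S \<union> \<Union>F) \<le> 0" "f (S \<inter> \<Union>F) \<le> 0"
    using sub by (auto intro!: nonpos)
  ultimately show ?case
    using \<open>f S = 0\<close> by simp
qed

text \<open>A single point of \<open>S\<close> suffices: by transitivity its orbit is all of
  \<open>E\<close>.\<close>

lemma (in transitive_action) Union_translates_eq:
  assumes "S \<subseteq> E" and "S \<noteq> {}"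
  shows "(\<Union>g\<in>carrier G. \<phi> g ` S) = E"
proof
  show "(\<Union>g\<in>carrier G. \<phi> g ` S) \<subseteq> E"
    using assms(1) surj_prop by blast
  show "E \<subseteq> (\<Union>g\<in>carrier G. \<phi> g ` S)"
    using assms unique_orbit by blast
qed

theorem theorem1p5:
  fixes V :: "'a set"
    and v :: "'a set \<Rightarrow> real"
    and \<Gamma> :: "('g, 'm) monoid_scheme"
    and \<phi> :: "'g \<Rightarrow> 'a \<Rightarrow> 'a"
    and U :: "'a set"
  assumes "finite V" and "V \<noteq> {}"
    and "v \<in> Pow V \<rightarrow> {0..1}"
    and "v {} = 0"
    and "supermodular_on V v"
    and "transitive_action \<Gamma> V \<phi>"
    and "invariant_under \<Gamma> \<phi> V v"
    and "U \<subseteq> V"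
  shows "v U \<le> real (card U) / real (card V) * v V"
proof -
  interpret transitive_action \<Gamma> V \<phi> by fact
  \<comment> \<open>The empty set is left out because the translates of a maximiser must cover
    \<open>V\<close>; its quotient would be 0 by the convention for division by zero.\<close>
  define A where "A = (\<lambda>S. v S / real (card S)) ` (Pow V - {{}})"
  have A: "finite A" "A \<noteq> {}"
    using assms(1,2) by (auto simp: A_def)
  define c where "c = Max A"
  define f where "f = (\<lambda>S. v S - c * real (card S))"
  have card_pos: "real (card S) > 0" if "S \<subseteq> V" "S \<noteq> {}" for S
    using that assms(1) by (simp add: card_gt_0_iff finite_subset)
  have f_empty: "f {} = 0"
    using assms(4) by (simp add: f_def)
  have nonpos: "f S \<le> 0" if "S \<subseteq> V" for S
  proof (cases "S = {}")
    case False
    then have "v S / real (card S) \<le> c"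
      unfolding c_def using A that by (intro Max_ge) (auto simp: A_def)
    then show ?thesis
      using card_pos[OF that False] by (simp add: f_def pos_divide_le_eq)
  qed (simp add: f_empty)
  obtain S where S: "S \<subseteq> V" "S \<noteq> {}" and "c = v S / real (card S)"
    using Max_in[OF A] by (auto simp: A_def c_def)
  then have "f S = 0"
    using card_pos[OF S] by (simp add: f_def)
  \<comment> \<open>Each group element acts injectively on \<open>V\<close>, so a translate keeps
    both the cardinality and the value of \<open>S\<close>.\<close>
  have "f (\<phi> g ` S) = 0" if "g \<in> carrier \<Gamma>" for g
  proof -
    have "card (\<phi> g ` S) = card S"
      using inj_prop[OF that] S(1) by (auto intro: card_image inj_on_subset)
    moreover have "v (\<phi> g ` S) = v S"
      using assms(7) that S(1) by (simp add: invariant_under_def)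
    ultimately show ?thesis
      using \<open>f S = 0\<close> by (simp add: f_def)
  qed
  moreover have cover: "(\<Union>g\<in>carrier \<Gamma>. \<phi> g ` S) = V"
    using S by (rule Union_translates_eq)
  \<comment> \<open>Even for an infinite group there are only finitely many distinct translates,
    since their union \<open>V\<close> is finite.\<close>
  moreover have "finite ((\<lambda>g. \<phi> g ` S) ` carrier \<Gamma>)"
    using cover assms(1) by (auto intro!: finite_UnionD)
  ultimately have "f V = 0"
    using supermodular_on_Union_eq_0[of V f "(\<lambda>g. \<phi> g ` S) ` carrier \<Gamma>"]
      supermodular_on_minus_card[OF assms(1,5), of c] nonpos f_empty
    unfolding f_def by (smt (verit) UN_upper image_iff)
  then have "c = v V / real (card V)"
    using card_pos[of V] assms(2) by (simp add: f_def field_simps)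
  \<comment> \<open>With this value of \<open>c\<close>, the claim is f U \<le> 0.\<close>
  then show ?thesis
    using nonpos[OF assms(8)] by (simp add: f_def mult.commute)
qed

end
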